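(* Let $N\ge 1$ be an integer, $a>0$, and let $P_n(x)$, $P_n^*(x)$ be the polynomials defined in the context. Then $$\frac{P_{2N-1}(x)}{2P_{N-1}(x)}=\frac{P_N(x)-P_{N-1}^*(x)/2}{2};$$ denote this polynomial by $g_N(x)$. The generating function of the polynomials $P_n(x)$ is given (as an identity of power series in $t$) by $$\sum_{n=0}^\infty P_n(x)t^n=\frac{1}{t^{2N}-2g_N(x)t^N+1}\left[\sum_{k=0}^{2N-2}P_k(x)t^k-2g_N(x)\sum_{k=0}^{N-2}P_k(x)t^{k+N}\right],$$ where an empty sum is $0$.
   Context: Let $q=e^{2\pi i/N}$, so $a(q^n+q^{-n})=2a\cos(2\pi n/N)$. The polynomials $P_n(x)$ are defined by $P_0(x)=1$, $P_1(x)=2x-2a$ and $$2xP_n(x)=P_{n+1}(x)+a(q^n+q^{-n})P_n(x)+P_{n-1}(x),\quad n\ge1.$$ The numerator polynomials $P_n^*(x)$ are defined by the same recurrence for $n\ge 1$, i.e. $2xP_n^*(x)=P_{n+1}^*(x)+a(q^n+q^{-n})P_n^*(x)+P_{n-1}^*(x)$, with $P_0^*(x)=0$ and $P_1^*(x)=2$. *)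

theory Defs
  imports "HOL-Computational_Algebra.Computational_Algebra" "HOL-Analysis.Analysis"
begin

definition q_root :: "nat \<Rightarrow> complex" where
  "q_root N = exp (2 * of_real pi * \<i> / of_nat N)"

definition rec_coeff :: "nat \<Rightarrow> real \<Rightarrow> nat \<Rightarrow> complex" where
  "rec_coeff N a n = of_real a * (q_root N powi int n + q_root N powi (- int n))"

fun P_poly :: "nat \<Rightarrow> real \<Rightarrow> nat \<Rightarrow> complex poly" where
  "P_poly N a 0 = 1"
| "P_poly N a (Suc 0) = [:- 2 * of_real a, 2:]"
| "P_poly N a (Suc (Suc n)) =
     [:- rec_coeff N a (Suc n), 2:] * P_poly N a (Suc n) - P_poly N a n"

fun num_poly :: "nat \<Rightarrow> real \<Rightarrow> nat \<Rightarrow> complex poly" where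
  "num_poly N a 0 = 0"
| "num_poly N a (Suc 0) = 2"
| "num_poly N a (Suc (Suc n)) =
     [:- rec_coeff N a (Suc n), 2:] * num_poly N a (Suc n) - num_poly N a n"

definition g_poly :: "nat \<Rightarrow> real \<Rightarrow> complex poly" where
  "g_poly N a = smult (1/2) (P_poly N a N - smult (1/2) (num_poly N a (N - 1)))"

lemma rec_coeff_cos:
  "rec_coeff N a n = of_real (2 * a * cos (2 * pi * real n / real N))"
proof -
  define \<theta> where "\<theta> = 2 * pi * real n / real N"
  have 1: "q_root N powi int n = cis \<theta>"
    by (simp add: q_root_def \<theta>_def cis_conv_exp exp_of_nat_mult [symmetric] mult_ac)
  have "rec_coeff N a n = of_real a * (cis \<theta> + cis (- \<theta>))"
    unfolding rec_coeff_def power_int_minus 1 by (simp add: cis_inverse)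
  also have "\<dots> = of_real (2 * a * cos \<theta>)"
    by (simp add: complex_eq_iff)
  finally show ?thesis by (simp add: \<theta>_def)
qed

lemma P_poly_recurrence:
  assumes "n \<ge> 1"
  shows "2 * x * poly (P_poly N a n) x =
    poly (P_poly N a (n + 1)) x + rec_coeff N a n * poly (P_poly N a n) x
      + poly (P_poly N a (n - 1)) x"
  using assms by (cases n) (auto simp: algebra_simps)

lemma num_poly_recurrence:
  assumes "n \<ge> 1"
  shows "2 * x * poly (num_poly N a n) x =
    poly (num_poly N a (n + 1)) x + rec_coeff N a n * poly (num_poly N a n) x
      + poly (num_poly N a (n - 1)) x"
  using assms by (cases n) (auto simp: algebra_simps)

end

theory Submission
  imports Defs
begin

text \<open>
  The coefficients of the recurrence have period \<open>N\<close>, so shifting a solution by \<open>N\<close> acts linearly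
  on the two-dimensional solution space, by a monodromy matrix whose determinant is \<open>1\<close>
  (constancy of the Wronskian) and whose trace is \<open>P\<^sub>N - P\<^sup>*\<^sub>N\<^sub>-\<^sub>1 / 2 = 2 g\<^sub>N\<close>. By Cayley--Hamilton,
  \<open>P\<^sub>n\<^sub>+\<^sub>2\<^sub>N = 2 g\<^sub>N P\<^sub>n\<^sub>+\<^sub>N - P\<^sub>n\<close> for all \<open>n \<ge> -1\<close>, where \<open>P\<^sub>-\<^sub>1 = 0\<close>. The case \<open>n = -1\<close> is the
  quotient formula for \<open>g\<^sub>N\<close>, and the remaining cases give the generating function.
\<close>

text \<open>In the application \<open>b n\<close> is \<open>2x - rec_coeff N a n\<close> and
  \<open>Q\<close> is half the numerator polynomial, so that \<open>Q 1 = 1\<close>. The initial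
  values amount to running both recurrences from index 0 with P(-1) = 0 and Q(-1) = -1.\<close>

locale three_term_recurrence =
  fixes b P Q :: "nat \<Rightarrow> 'a :: comm_ring_1"
  assumes P_0: "P 0 = 1" and P_1: "P (Suc 0) = b 0"
    and P_Suc_Suc: "\<And>n. P (Suc (Suc n)) = b (Suc n) * P (Suc n) - P n"
    and Q_0: "Q 0 = 0" and Q_1: "Q (Suc 0) = 1"
    and Q_Suc_Suc: "\<And>n. Q (Suc (Suc n)) = b (Suc n) * Q (Suc n) - Q n"
begin

lemma wronskian: "P n * Q (Suc n) - P (Suc n) * Q n = 1"
  by (induction n) (simp_all add: P_0 P_1 Q_0 Q_1 P_Suc_Suc Q_Suc_Suc algebra_simps)

context
  fixes m :: nat
  assumes periodic: "\<And>n. b (n + Suc m) = b n"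
begin

text \<open>By periodicity both sides solve the same recurrence in \<open>n\<close>, so agreement at
  0 and 1 suffices.\<close>

lemma solution_shift:
  assumes y: "\<And>n. y (Suc (Suc n)) = b (Suc n) * y (Suc n) - y n"
  shows "y (n + Suc m) = y (Suc m) * P n - y m * Q n"
proof (induction n rule: induct_nat_012)
  case 0
  then show ?case by (simp add: P_0 Q_0)
next
  case 1
  have "b (Suc m) = b 0" using periodic[of 0] by simp
  then show ?case by (simp add: P_1 Q_1 y)
next
  case (ge2 n)
  have "y (Suc (Suc n) + Suc m) = b (Suc n) * y (Suc n + Suc m) - y (n + Suc m)"
    using y[of "n + Suc m"] periodic[of "Suc n"] by simp
  then show ?case
    unfolding ge2 by (simp add: P_Suc_Suc Q_Suc_Suc algebra_simps)
qed

lemmas P_shift = solution_shift[of P, OF P_Suc_Suc]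
lemmas Q_shift = solution_shift[of Q, OF Q_Suc_Suc]

lemma P_double_period: "P (n + 2 * Suc m) = (P (Suc m) - Q m) * P (n + Suc m) - P n"
proof -
  have "P (n + 2 * Suc m) = P (Suc m) * P (n + Suc m) - P m * Q (n + Suc m)"
    using P_shift[of "n + Suc m"] by (simp only: mult_2 add.assoc)
  also have "P m * Q (n + Suc m) = P m * Q (Suc m) * P n - Q m * (P m * Q n)"
    unfolding Q_shift by (simp add: algebra_simps)
  \<comment> \<open>The shift formula for \<open>P\<close> is solved for its \<open>Q\<close> term,
    so that only values of \<open>P\<close> remain; the Wronskian then supplies the determinant
    1.\<close>
  also have "P m * Q n = P (Suc m) * P n - P (n + Suc m)"
    unfolding P_shift by simp
  also have "P m * Q (Suc m) = 1 + P (Suc m) * Q m"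
    using wronskian[of m] by (simp add: algebra_simps)
  finally show ?thesis by (simp add: algebra_simps)
qed

text \<open>This is \<open>P_double_period\<close> at index -1, which a natural \<open>n\<close>
  cannot reach; it is the shift of \<open>P\<close> evaluated at \<open>m\<close>.\<close>

lemma P_double_period_pred: "P (2 * m + 1) = (P (Suc m) - Q m) * P m"
proof -
  have "2 * m + 1 = m + Suc m" by simp
  then show ?thesis by (simp only: P_shift) (simp add: algebra_simps)
qed

end

end

lemma rec_coeff_periodic:
  assumes "N \<ge> 1"
  shows "rec_coeff N a (n + N) = rec_coeff N a n"
proof -
  have "2 * pi * real (n + N) / real N = 2 * pi * real n / real N + 2 * pi"
    using assms by (simp add: field_simps)
  then show ?thesis by (simp add: rec_coeff_cos)
qed

lemma rec_coeff_0: "rec_coeff N a 0 = 2 * of_real a"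
  by (simp add: rec_coeff_def)

lemma P_poly_recurrence_locale:
  "three_term_recurrence (\<lambda>n. [:- rec_coeff N a n, 2:]) (P_poly N a)
    (\<lambda>n. smult (1/2) (num_poly N a n))"
  by standard (simp_all add: rec_coeff_0 smult_diff_right numeral_poly one_pCons)

lemma P_poly_double_period:
  assumes "N \<ge> 1"
  shows "P_poly N a (n + 2 * N) = smult 2 (g_poly N a) * P_poly N a (n + N) - P_poly N a n"
    and "P_poly N a (2 * N - 1) = smult 2 (g_poly N a) * P_poly N a (N - 1)"
proof -
  interpret three_term_recurrence "\<lambda>n. [:- rec_coeff N a n, 2:]" "P_poly N a"
    "\<lambda>n. smult (1/2) (num_poly N a n)"
    by (rule P_poly_recurrence_locale)
  obtain m where N: "N = Suc m" using assms by (cases N) auto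
  have periodic: "[:- rec_coeff N a (n + Suc m), 2:] = [:- rec_coeff N a n, 2:]" for n
    using rec_coeff_periodic[OF assms] by (simp add: N)
  have g: "smult 2 (g_poly N a) = P_poly N a (Suc m) - smult (1/2) (num_poly N a m)"
    by (simp add: g_poly_def N)
  show "P_poly N a (n + 2 * N) = smult 2 (g_poly N a) * P_poly N a (n + N) - P_poly N a n"
    unfolding g using P_double_period[OF periodic, of n] by (simp only: N)
  show "P_poly N a (2 * N - 1) = smult 2 (g_poly N a) * P_poly N a (N - 1)"
    unfolding g using P_double_period_pred[OF periodic] by (simp add: N del: P_poly.simps)
qed

text \<open>Makes division by \<open>P_poly N a (N - 1)\<close> meaningful. The factor with leading
  term 2x raises the degree by one, and the subtracted polynomial is too low to cancel it.\<close>

lemma P_poly_degree: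
  "degree (P_poly N a n) = n \<and> P_poly N a n \<noteq> 0"
proof (induction n rule: induct_nat_012)
  case (ge2 n)
  have "degree ([:- rec_coeff N a (Suc n), 2:] * P_poly N a (Suc n)) = Suc (Suc n)"
    using ge2 by (subst degree_mult_eq) auto
  then have "degree (P_poly N a (Suc (Suc n))) = Suc (Suc n)"
    unfolding P_poly.simps diff_conv_add_uminus
    using ge2 by (subst degree_add_eq_left) simp_all
  then show ?case by (metis degree_0 nat.distinct(1))
qed simp_all

text \<open>Multiplying by the denominator, whose constant term is 1, reduces the claim to a
  comparison of coefficients.\<close>

lemma fps_eq_divide_of_recurrence:
  fixes f :: "nat \<Rightarrow> 'a :: field" and c :: 'a
  assumes N: "N \<ge> 1"
    and rec: "\<And>n. f (n + 2 * N) = c * f (n + N) - f n"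
    and rec_pred: "f (2 * N - 1) = c * f (N - 1)"
  shows "Abs_fps f = 1 / (fps_X ^ (2 * N) - fps_const c * fps_X ^ N + 1)
    * ((\<Sum>k<2 * N - 1. fps_const (f k) * fps_X ^ k)
       - fps_const c * (\<Sum>k<N - 1. fps_const (f k) * fps_X ^ (k + N)))"
    (is "?F = 1 / ?D * ?R")
proof -
  have D0: "fps_nth ?D 0 \<noteq> 0" using N by simp
  have "?D * ?F = ?R"
  proof (rule fps_ext)
    fix n
    have L: "fps_nth (?D * ?F) n = (if n < 2 * N then 0 else f (n - 2 * N))
        - c * (if n < N then 0 else f (n - N)) + f n"
      by (simp add: ring_distribs fps_X_power_mult_nth mult.assoc)
    have S1: "fps_nth (\<Sum>k<2 * N - 1. fps_const (f k) * fps_X ^ k) n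
        = (if n < 2 * N - 1 then f n else 0)"
      by (simp add: fps_sum_nth if_distrib cong: if_cong)
    have "fps_nth (\<Sum>k<N - 1. fps_const (f k) * fps_X ^ (k + N)) n
        = (\<Sum>k<N - 1. if n = k + N then f k else 0)"
      by (simp add: fps_sum_nth if_distrib cong: if_cong)
    \<comment> \<open>For \<open>n < N\<close> the truncated \<open>n - N\<close> is 0 and would
      match \<open>k = 0\<close> wrongly; the inner test on \<open>N \<le> n\<close> prevents
      this.\<close>
    also have "\<dots> = (\<Sum>k<N - 1. if k = n - N then (if N \<le> n then f (n - N) else 0) else 0)"
      by (rule sum.cong) auto
    also have "\<dots> = (if N \<le> n \<and> n < 2 * N - 1 then f (n - N) else 0)"
      by auto
    finally have S2: "fps_nth (\<Sum>k<N - 1. fps_const (f k) * fps_X ^ (k + N)) n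
        = (if N \<le> n \<and> n < 2 * N - 1 then f (n - N) else 0)" .
    have R: "fps_nth ?R n = (if n < 2 * N - 1 then f n else 0)
        - c * (if N \<le> n \<and> n < 2 * N - 1 then f (n - N) else 0)"
      by (simp only: fps_sub_nth fps_mult_left_const_nth S1 S2)
    \<comment> \<open>Below \<open>2 * N - 1\<close> the numerator is the truncated product itself.
      From there on its coefficients vanish: first by \<open>rec_pred\<close>, then by
      \<open>rec\<close>.\<close>
    consider "n < 2 * N - 1" | "n = 2 * N - 1" | k where "n = k + 2 * N"
    proof -
      have "n < 2 * N - 1 \<or> n = 2 * N - 1 \<or> n = (n - 2 * N) + 2 * N" by linarith
      then show thesis using that by blast
    qed
    then show "fps_nth (?D * ?F) n = fps_nth ?R n"
    proof cases
      case 1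
      then show ?thesis unfolding L R by auto
    next
      case 2
      then have "n - N = N - 1" "\<not> n < N" "n < 2 * N" using N by auto
      then show ?thesis unfolding L R using 2 rec_pred by simp
    next
      case 3
      then have "n - N = k + N" "n - 2 * N = k" "\<not> n < N" "\<not> n < 2 * N" "\<not> n < 2 * N - 1"
        by simp_all
      then show ?thesis unfolding L R using 3 rec[of k] by (simp add: add.commute)
    qed
  qed
  then have "inverse ?D * ?R = inverse ?D * ?D * ?F"
    by (simp only: mult.assoc)
  also have "\<dots> = ?F"
    by (simp only: inverse_mult_eq_1[OF D0] mult_1_left)
  finally show ?thesis
    by (simp only: fps_divide_unit[OF D0] mult_1_left)
qed

theorem theorem2p1:
  fixes N :: nat and a :: real
  assumes "N \<ge> 1" and "a > 0"
  shows "P_poly N a (N - 1) \<noteq> 0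
    \<and> to_fract (P_poly N a (2 * N - 1)) / (2 * to_fract (P_poly N a (N - 1)))
        = to_fract (g_poly N a)
    \<and> to_fract (g_poly N a)
        = (to_fract (P_poly N a N) - to_fract (num_poly N a (N - 1)) / 2) / 2
    \<and> (\<forall>x :: complex.
        Abs_fps (\<lambda>n. poly (P_poly N a n) x)
        = 1 / (fps_X ^ (2 * N) - fps_const (2 * poly (g_poly N a) x) * fps_X ^ N + 1)
          * ((\<Sum>k<2 * N - 1. fps_const (poly (P_poly N a k) x) * fps_X ^ k)
             - fps_const (2 * poly (g_poly N a) x)
               * (\<Sum>k<N - 1. fps_const (poly (P_poly N a k) x) * fps_X ^ (k + N))))"
proof (intro conjI allI)
  show nz: "P_poly N a (N - 1) \<noteq> 0"
    by (simp add: P_poly_degree)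
  have two: "to_fract (smult 2 p) = 2 * to_fract p" for p :: "complex poly"
  proof -
    have "smult 2 p = p + p" by (metis one_add_one smult_1_left smult_add_left)
    then show ?thesis by (simp only: to_fract_add mult_2)
  qed
  \<comment> \<open>Needed to cancel 2 in the fraction field; it follows from injectivity of
    \<open>to_fract\<close>.\<close>
  have two_nz: "(2 :: complex poly fract) \<noteq> 0"
  proof
    assume "(2 :: complex poly fract) = 0"
    with two[of 1] have "to_fract (smult 2 (1 :: complex poly)) = 0" by simp
    then show False by (simp only: to_fract_eq_0_iff smult_eq_0_iff) simp
  qed
  have half: "to_fract (smult (1/2) p) = to_fract p / 2" for p :: "complex poly"
    using two[of "smult (1/2) p"] two_nz by (simp add: field_simps)
  show "to_fract (P_poly N a (2 * N - 1)) / (2 * to_fract (P_poly N a (N - 1)))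
      = to_fract (g_poly N a)"
    using nz two_nz
    by (simp only: P_poly_double_period(2)[OF assms(1)] to_fract_mult two) simp
  show "to_fract (g_poly N a)
      = (to_fract (P_poly N a N) - to_fract (num_poly N a (N - 1)) / 2) / 2"
    by (simp only: g_poly_def half to_fract_diff)
  fix x :: complex
  show "Abs_fps (\<lambda>n. poly (P_poly N a n) x)
        = 1 / (fps_X ^ (2 * N) - fps_const (2 * poly (g_poly N a) x) * fps_X ^ N + 1)
          * ((\<Sum>k<2 * N - 1. fps_const (poly (P_poly N a k) x) * fps_X ^ k)
             - fps_const (2 * poly (g_poly N a) x)
               * (\<Sum>k<N - 1. fps_const (poly (P_poly N a k) x) * fps_X ^ (k + N)))"
    by (rule fps_eq_divide_of_recurrence[OF assms(1)])
       (simp_all only: P_poly_double_period[OF assms(1)] poly_diff poly_mult poly_smult)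
qed

end
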